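(* Let $n\geq1$ and let $T\in\mathcal{C}_{n}$ have minimal polynomial $m$ of degree $|m|$, with zeros (counted with multiplicity) $\sigma=(\lambda_{1},\lambda_{2},\dots,\lambda_{|m|})\in\mathbb{D}^{|m|}$. Then for every $\zeta\in\mathbb{C}$ with $|\zeta|\geq1$, $$\|R(\zeta,T)\|\leq\sum_{k=1}^{|m|}\frac{1+|\lambda_{k}|}{1-|\lambda_{k}|}.$$ In particular, for every $n\geq1$ and every $r\in[0,1)$, $$\mathcal{R}_{n,r}\leq\frac{1+r}{1-r}\,n.$$ Moreover, for every $n\geq1$ and every $r\in[0,1)$, $$\mathcal{R}_{n,r}\geq\frac{1}{2}\,\frac{1+r}{1-r}\,n+\frac{1}{2}.$$
   Context: $\mathbb{D}=\{z\in\mathbb{C}:|z|<1\}$ is the open unit disc. For a complex $n\times n$ matrix $T$, $\|T\|$ is the operator norm associated with the standard Hilbert (Euclidean) norm on $\mathbb{C}^{n}$, and $\rho(T)$ is the spectral radius (the maximum modulus of the eigenvalues). $\mathcal{C}_{n}$ is the set of complex $n\times n$ matrices $T$ with $\|T\|\leq1$ (contractions). For $\zeta$ not an eigenvalue of $T$, $R(\zeta,T)=(\zeta-T)^{-1}$, where a scalar $\zeta$ stands for $\zeta$ times the identity matrix. For $n\geq1$ and $r\in[0,1)$, $$\mathcal{R}_{n,r}:=\sup\{\|R(\zeta,T)\| : T\in\mathcal{C}_{n},\ \rho(T)\leq r\},$$ where $\zeta$ is any complex number with $|\zeta|=1$ (the value does not depend on the choice of such $\zeta$). *)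

theory Defs
  imports "HOL-Analysis.Analysis" "HOL-Computational_Algebra.Polynomial"
begin

text \<open>Since \<open>norm\<close> on \<open>complex^'n\<close> is the Euclidean norm, \<open>onorm\<close> gives the Hilbert-space
  operator norm.\<close>

definition opnorm :: "complex^'n^'n \<Rightarrow> real" where
  "opnorm A = onorm ((*v) A)"

definition contraction :: "complex^'n^'n \<Rightarrow> bool" where
  "contraction T \<longleftrightarrow> opnorm T \<le> 1"

definition eigenvalues :: "complex^'n^'n \<Rightarrow> complex set" where
  "eigenvalues T = {c. \<exists>v. v \<noteq> 0 \<and> T *v v = c *s v}"

definition spectral_radius :: "complex^'n^'n \<Rightarrow> real" where
  "spectral_radius T = Max (cmod ` eigenvalues T)"

definition resolvent :: "complex \<Rightarrow> complex^'n^'n \<Rightarrow> complex^'n^'n" where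
  "resolvent \<zeta> T = matrix_inv (mat \<zeta> - T)"

text \<open>\<open>matrix_inv\<close> is meaningful only for invertible matrices.\<close>

lemma invertible_resolvent:
  fixes T :: "complex^'n^'n"
  assumes "\<zeta> \<notin> eigenvalues T"
  shows "invertible (mat \<zeta> - T)"
proof -
  have "mat \<zeta> *v x = \<zeta> *s x" for x :: "complex^'n"
    by (simp add: vec_eq_iff matrix_vector_mult_def mat_def if_distrib if_distribR cong: if_cong)
  then have "x = 0" if "(mat \<zeta> - T) *v x = 0" for x
    using assms that by (metis (mono_tags, lifting) eigenvalues_def eq_iff_diff_eq_0
      matrix_vector_mult_diff_rdistrib mem_Collect_eq)
  then show ?thesis
    by (simp add: invertible_left_inverse matrix_left_invertible_ker)
qed

text \<open>The square-matrix type carries componentwise multiplication, so the powers of \<open>T\<close> are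
  formed with \<open>**\<close>.\<close>

definition poly_matrix :: "complex poly \<Rightarrow> complex^'n^'n \<Rightarrow> complex^'n^'n" where
  "poly_matrix p T = (\<Sum>i\<le>degree p. mat (coeff p i) ** (((**) T ^^ i) (mat 1)))"

definition minimal_polynomial :: "complex^'n^'n \<Rightarrow> complex poly \<Rightarrow> bool" where
  "minimal_polynomial T m \<longleftrightarrow> lead_coeff m = 1 \<and> poly_matrix m T = 0 \<and>
     (\<forall>q. q \<noteq> 0 \<and> poly_matrix q T = 0 \<longrightarrow> degree m \<le> degree q)"

text \<open>The dimension enters as \<open>CARD('n)\<close>. The supremum is taken in \<open>ereal\<close>, so that it is
  the true supremum without a prior proof of boundedness.\<close>

definition resolvent_sup :: "'n::finite itself \<Rightarrow> complex \<Rightarrow> real \<Rightarrow> ereal" where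
  "resolvent_sup _ \<zeta> r =
     (SUP T \<in> {T :: complex^'n^'n. contraction T \<and> spectral_radius T \<le> r}.
        ereal (opnorm (resolvent \<zeta> T)))"

end

theory Submission
  imports Defs "HOL-Computational_Algebra.Fundamental_Theorem_Algebra"
begin

text \<open>
  Let \<open>B\<^sub>k\<close> be the Blaschke factor of \<open>\<lambda>\<^sub>k\<close>. Since \<open>m(T) = 0\<close>, the product of the contractions
  \<open>B\<^sub>k(T)\<close> vanishes. Hence the telescoping expansion of
  \<open>1 - (\<Prod>k. B\<^sub>k(z) / B\<^sub>k(\<zeta>))\<close>, divided by \<open>\<zeta> - z\<close> and evaluated at \<open>T\<close>, writes the resolvent as a
  sum whose \<open>k\<close>-th term is a contraction times
  \<open>(1 - \<bar>\<lambda>\<^sub>k\<bar>\<^sup>2) / (\<zeta> - \<lambda>\<^sub>k)\<close> times the inverse of \<open>1 - cnj \<lambda>\<^sub>k T\<close>, and so has norm at most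
  \<open>(1 + \<bar>\<lambda>\<^sub>k\<bar>) / (1 - \<bar>\<lambda>\<^sub>k\<bar>)\<close>. For the bound in terms of \<open>n\<close> it suffices that some product of at
  most \<open>n\<close> factors \<open>T - \<lambda>\<close>, with \<open>\<lambda>\<close> an eigenvalue, vanishes: on a nonzero invariant subspace \<open>V\<close> choose
  an eigenvalue \<open>\<lambda>\<close>; then \<open>(T - \<lambda>) V\<close> is invariant and of smaller dimension.
\<close>

subsection \<open>Contractions and Blaschke factors\<close>

lemma mat_vector_mult: "mat c *v x = c *s (x :: complex^'n)"
  by (simp add: vec_eq_iff matrix_vector_mult_def mat_def if_distrib if_distribR cong: if_cong)

lemma norm_vector_smult: "norm (c *s (x :: complex^'n)) = cmod c * norm x"
  by (simp add: norm_vec_def norm_mult L2_set_right_distrib)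

lemma contraction_iff: "contraction T \<longleftrightarrow> (\<forall>x :: complex^'n. norm (T *v x) \<le> norm x)"
proof
  assume T: "contraction T"
  show "\<forall>x. norm (T *v x) \<le> norm x"
  proof
    fix x
    have "norm (T *v x) \<le> onorm ((*v) T) * norm x"
      by (rule onorm) (rule matrix_vector_mul_bounded_linear)
    also have "\<dots> \<le> 1 * norm x"
      using T unfolding contraction_def opnorm_def by (rule mult_right_mono) simp
    finally show "norm (T *v x) \<le> norm x" by simp
  qed
next
  assume "\<forall>x. norm (T *v x) \<le> norm x"
  then show "contraction T"
    unfolding contraction_def opnorm_def by (intro onorm_le) simp
qed

text \<open>Multiplied out, this says that a Blaschke factor maps contractions to contractions.\<close>

lemma norm_blaschke_le:
  fixes x t :: "complex^'n"
  assumes "norm t \<le> norm x" "cmod l \<le> 1"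
  shows "norm (t - l *s x) \<le> norm (x - cnj l *s t)"
proof -
  have c: "cmod (a - cnj l * b) ^ 2 - cmod (b - l * a) ^ 2 = (1 - cmod l ^ 2) * (cmod a ^ 2 - cmod b ^ 2)"
    for a b
    unfolding cmod_power2 by (simp add: power2_eq_square algebra_simps)
  have n2: "norm y ^ 2 = (\<Sum>i\<in>UNIV. cmod (y $ i) ^ 2)" for y :: "complex^'n"
    by (simp add: norm_vec_def L2_set_def sum_nonneg)
  have "norm (x - cnj l *s t) ^ 2 - norm (t - l *s x) ^ 2 = (1 - cmod l ^ 2) * (norm x ^ 2 - norm t ^ 2)"
    by (simp add: n2 c sum_distrib_left flip: sum_subtractf)
  moreover have "0 \<le> (1 - cmod l ^ 2) * (norm x ^ 2 - norm t ^ 2)"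
    using assms by (intro mult_nonneg_nonneg) (auto simp: power_mono power_le_one)
  ultimately show ?thesis
    by (metis diff_ge_0_iff_ge norm_ge_zero power2_le_imp_le)
qed

section \<open>Linear factors \<open>T - l\<close> and \<open>1 - l T\<close>\<close>

lemmas matrix_vector_smult_distribs =
  matrix_vector_mult_diff_distrib vector_scalar_commute

text \<open>Acting on vectors, head factor first, avoids matrix products and fits induction on the
  list.\<close>

primrec shift_prod :: "complex^'n^'n \<Rightarrow> complex list \<Rightarrow> complex^'n \<Rightarrow> complex^'n" where
  "shift_prod T [] x = x"
| "shift_prod T (l # ls) x = shift_prod T ls (T *v x - l *s x)"

lemma shift_prod_diff_smult:
  "shift_prod T ls (x - c *s y) = shift_prod T ls x - c *s shift_prod T ls y"
proof (induction ls arbitrary: x y)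
  case (Cons l ls)
  have "T *v (x - c *s y) - l *s (x - c *s y) = (T *v x - l *s x) - c *s (T *v y - l *s y)"
    by (simp add: algebra_simps vector_scalar_commute vec.scale_right_diff_distrib)
  then show ?case
    unfolding shift_prod.simps by (simp only: Cons.IH)
qed simp

lemma shift_prod_mult: "shift_prod T ls (T *v x) = T *v shift_prod T ls x"
proof (induction ls arbitrary: x)
  case (Cons l ls)
  have "T *v (T *v x) - l *s (T *v x) = T *v (T *v x - l *s x)"
    by (simp add: algebra_simps vector_scalar_commute)
  then show ?case
    using Cons.IH by simp
qed simp

text \<open>Consequently a list whose product vanishes must contain every eigenvalue.\<close>

lemma shift_prod_eigenvector:
  "T *v v = c *s v \<Longrightarrow> shift_prod T ls v = (\<Prod>l\<leftarrow>ls. c - l) *s v"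
proof (induction ls)
  case (Cons l ls)
  have "shift_prod T ls (0 - (l - c) *s v) = 0 - (l - c) *s shift_prod T ls v"
    using shift_prod_diff_smult[of T ls 0 "l - c" v] shift_prod_diff_smult[of T ls 0 1 0] by simp
  then show ?case
    using Cons by (simp add: vec.scale_left_diff_distrib algebra_simps)
qed simp

text \<open>The reverse triangle inequality makes \<open>1 - l T\<close> injective and bounds its
  inverse by \<open>1 / (1 - cmod l)\<close>.\<close>

lemma contraction_shift_lower_bound:
  assumes "contraction T" "cmod l < 1"
  shows "(1 - cmod l) * norm x \<le> norm (x - l *s (T *v x))"
proof -
  have "cmod l * norm (T *v x) \<le> cmod l * norm x"
    using assms by (simp add: contraction_iff mult_left_mono)
  then show ?thesis
    using norm_triangle_ineq2[of x "l *s (T *v x)"] by (simp add: norm_vector_smult algebra_simps)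
qed

text \<open>Injectivity suffices in finite dimension; \<open>u\<close> plays the part of the inverse
  of \<open>1 - l T\<close> applied to \<open>x\<close>.\<close>

lemma contraction_shift_surj:
  fixes T :: "complex^'n^'n"
  assumes "contraction T" "cmod l < 1"
  obtains u where "x = u - l *s (T *v u)"
proof -
  let ?D = "mat 1 - mat l ** T"
  have D: "?D *v y = y - l *s (T *v y)" for y
    by (simp only: matrix_vector_mult_diff_rdistrib mat_vector_mult matrix_vector_mul_assoc[symmetric] vec.scale_one)
  have "y = 0" if "?D *v y = 0" for y
    using contraction_shift_lower_bound[OF assms, of y] that assms(2) unfolding D
    by (simp add: mult_le_0_iff)
  then have "\<exists>D'. D' ** ?D = mat 1"
    by (simp add: matrix_left_invertible_ker)
  then obtain D' where "?D ** D' = mat 1"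
    using matrix_left_right_inverse by blast
  then have "x = ?D *v (D' *v x)"
    by (simp add: matrix_vector_mul_assoc)
  then show ?thesis
    by (intro that[of "D' *v x"]) (simp only: D[symmetric])
qed

text \<open>For \<open>B\<close> the Blaschke factor of \<open>l\<close> and \<open>c = 1 / B(\<zeta>)\<close>, one splits
  \<open>x = (x - c B(T) x) + c B(T) x\<close>; the first summand is
  \<open>(1 - \<bar>l\<bar>\<^sup>2) / (\<zeta> - l)\<close> times \<open>(1 - cnj l T)\<^sup>-\<^sup>1 (\<zeta> - T) x\<close>.\<close>

lemma norm_le_of_shift_prod_eq_0:
  fixes T :: "complex^'n^'n"
  assumes T: "contraction T" and z: "cmod \<zeta> \<ge> 1"
  shows "\<forall>l\<in>set ls. cmod l < 1 \<Longrightarrow> shift_prod T ls x = 0 \<Longrightarrow>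
    norm x \<le> (\<Sum>l\<leftarrow>ls. (1 + cmod l) / (1 - cmod l)) * norm (\<zeta> *s x - T *v x)"
proof (induction ls arbitrary: x)
  case (Cons l ls)
  have l: "cmod l < 1" "cmod (cnj l) < 1" using Cons.prems by auto
  obtain u where u: "x = u - cnj l *s (T *v u)"
    using contraction_shift_surj[OF T l(2)] .
  \<comment> \<open>Here \<open>w\<close> is \<open>B(T) x\<close>, and \<open>v\<close> is the
    inverse of \<open>1 - cnj l T\<close> applied to \<open>y\<close>.\<close>
  define w where "w = T *v u - l *s u"
  define v where "v = \<zeta> *s u - T *v u"
  define y where "y = \<zeta> *s x - T *v x"
  let ?k = "(1 + cmod l) / (1 - cmod l)"
  have y: "y = v - cnj l *s (T *v v)"
    unfolding y_def u v_def by (simp only: matrix_vector_smult_distribs) (simp add: vec_eq_iff algebra_simps)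
  have w: "\<zeta> *s w - T *v w = T *v v - l *s v"
    unfolding v_def w_def by (simp only: matrix_vector_smult_distribs) (simp add: vec_eq_iff algebra_simps)
  \<comment> \<open>Cancelling the injective factor \<open>1 - cnj l T\<close> shows that the
    remaining list annihilates \<open>w\<close>.\<close>
  have "T *v x - l *s x = w - cnj l *s (T *v w)"
    unfolding u w_def by (simp only: matrix_vector_smult_distribs) (simp add: vec_eq_iff algebra_simps)
  then have "shift_prod T ls w - cnj l *s (T *v shift_prod T ls w) = shift_prod T (l # ls) x"
    by (simp only: shift_prod.simps shift_prod_diff_smult shift_prod_mult)
  then have "shift_prod T ls w = 0"
    using contraction_shift_lower_bound[OF T l(2), of "shift_prod T ls w"] Cons.prems(2) l
    by (simp add: mult_le_0_iff)
  then have "norm w \<le> (\<Sum>l\<leftarrow>ls. (1 + cmod l) / (1 - cmod l)) * norm (T *v v - l *s v)"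
    using Cons.IH[of w] Cons.prems(1) w by simp
  \<comment> \<open>\<open>T *v v - l *s v\<close> is \<open>B(T) y\<close>, and \<open>B(T)\<close>
    is a contraction.\<close>
  also have "\<dots> \<le> (\<Sum>l\<leftarrow>ls. (1 + cmod l) / (1 - cmod l)) * norm y"
    unfolding y using T l Cons.prems(1)
    by (intro mult_left_mono norm_blaschke_le sum_list_nonneg)
      (auto simp: contraction_iff less_imp_le)
  finally have w_le: "norm w \<le> (\<Sum>l\<leftarrow>ls. (1 + cmod l) / (1 - cmod l)) * norm y" .
  have zl: "1 - cmod l \<le> cmod (\<zeta> - l)"
    using norm_triangle_ineq2[of \<zeta> l] z by simp
  \<comment> \<open>The splitting of \<open>x\<close> multiplied by \<open>\<zeta> - l\<close>,
    which clears the denominators.\<close>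
  have "(\<zeta> - l) *s x = (1 - cnj l * \<zeta>) *s w + (1 - l * cnj l) *s v"
    unfolding u v_def w_def by (simp add: vec_eq_iff algebra_simps)
  then have 1: "cmod (\<zeta> - l) * norm x \<le> cmod (1 - cnj l * \<zeta>) * norm w + cmod (1 - l * cnj l) * norm v"
    by (metis norm_triangle_ineq norm_vector_smult)
  have 2: "cmod (1 - l * cnj l) = (1 - cmod l) * (1 + cmod l)"
  proof -
    have "1 - l * cnj l = of_real ((1 - cmod l) * (1 + cmod l))"
      by (simp only: complex_norm_square[symmetric]) (simp add: algebra_simps power2_eq_square)
    then show ?thesis
      using l by (simp only: norm_of_real) simp
  qed
  have "(1 + cmod l) * ((1 - cmod l) * norm v) \<le> (1 + cmod l) * norm y"
    unfolding y using contraction_shift_lower_bound[OF T l(2), of v]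
    by (intro mult_left_mono) simp_all
  also have "(1 + cmod l) * norm y \<le> cmod (\<zeta> - l) * (?k * norm y)"
  proof -
    have "(1 + cmod l) * norm y = (1 - cmod l) * (?k * norm y)"
      using l by simp
    also have "\<dots> \<le> cmod (\<zeta> - l) * (?k * norm y)"
      using l zl by (intro mult_right_mono) auto
    finally show ?thesis .
  qed
  finally have 3: "cmod (1 - l * cnj l) * norm v \<le> cmod (\<zeta> - l) * (?k * norm y)"
    unfolding 2 by (simp only: mult_ac)
  \<comment> \<open>This is \<open>cmod (1 / B(\<zeta>)) \<le> 1\<close>, multiplied out: the
    one-dimensional Blaschke estimate with 1 and \<open>cnj \<zeta>\<close> as \<open>t\<close> and
    \<open>x\<close>.\<close>
  have "cmod (1 - cnj l * \<zeta>) \<le> cmod (\<zeta> - l)"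
  proof -
    have "norm (vec 1 - l *s vec (cnj \<zeta>) :: complex^1) \<le> norm (vec (cnj \<zeta>) - cnj l *s vec 1 :: complex^1)"
      using z l by (intro norm_blaschke_le) (auto simp: norm_vector_1)
    then have "cmod (1 - l * cnj \<zeta>) \<le> cmod (cnj \<zeta> - cnj l)"
      by (simp add: norm_vector_1)
    then show ?thesis
      using complex_mod_cnj[of "1 - l * cnj \<zeta>"] complex_mod_cnj[of "\<zeta> - l"] by simp
  qed
  then have "cmod (1 - cnj l * \<zeta>) * norm w \<le> cmod (\<zeta> - l) * norm w"
    by (rule mult_right_mono) simp
  with 1 3 have "cmod (\<zeta> - l) * norm x \<le> cmod (\<zeta> - l) * (norm w + ?k * norm y)"
    by (simp only: distrib_left)
  then have "norm x \<le> norm w + ?k * norm y"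
    using zl l(1) by (subst (asm) mult_le_cancel_left_pos) auto
  then show ?case
    using w_le by (simp add: y_def algebra_simps)
qed simp

lemma matrix_inv_right:
  "invertible A \<Longrightarrow> A ** matrix_inv A = mat 1"
  unfolding invertible_def matrix_inv_def by (rule someI2_ex) auto

lemma matrix_inv_left:
  "invertible A \<Longrightarrow> matrix_inv A ** A = mat 1"
  unfolding invertible_def matrix_inv_def by (rule someI2_ex) auto

text \<open>The vector estimate bounds \<open>\<zeta> - T\<close> from below; this yields first
  invertibility, then the norm of the inverse.\<close>

lemma opnorm_resolvent_le:
  fixes T :: "complex^'n^'n"
  assumes T: "contraction T" and z: "cmod \<zeta> \<ge> 1"
    and ls: "\<forall>l\<in>set ls. cmod l < 1" and 0: "\<And>x. shift_prod T ls x = 0"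
  shows "opnorm (resolvent \<zeta> T) \<le> (\<Sum>l\<leftarrow>ls. (1 + cmod l) / (1 - cmod l))"
proof -
  let ?K = "\<Sum>l\<leftarrow>ls. (1 + cmod l) / (1 - cmod l)"
  have le: "norm x \<le> ?K * norm ((mat \<zeta> - T) *v x)" for x
    using norm_le_of_shift_prod_eq_0[OF T z ls 0]
    by (simp add: matrix_vector_mult_diff_rdistrib mat_vector_mult)
  have "x = 0" if "(mat \<zeta> - T) *v x = 0" for x
    using le[of x] that by simp
  then have "\<exists>S. S ** (mat \<zeta> - T) = mat 1"
    by (simp add: matrix_left_invertible_ker)
  then have "invertible (mat \<zeta> - T)"
    by (simp add: invertible_left_inverse)
  then have "(mat \<zeta> - T) ** resolvent \<zeta> T = mat 1"
    unfolding resolvent_def by (rule matrix_inv_right)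
  then have inv: "(mat \<zeta> - T) *v (resolvent \<zeta> T *v y) = y" for y
    by (simp add: matrix_vector_mul_assoc)
  show ?thesis
    unfolding opnorm_def
  proof (rule onorm_le)
    show "norm (resolvent \<zeta> T *v y) \<le> ?K * norm y" for y
      using le[of "resolvent \<zeta> T *v y"] unfolding inv .
  qed
qed

subsection \<open>Annihilating products of linear factors\<close>

lemma poly_matrix_mult_vector:
  "poly_matrix p T *v x = (\<Sum>i\<le>degree p. coeff p i *s ((*v) T ^^ i) x)"
proof -
  have pow: "(((**) T ^^ i) (mat 1)) *v x = ((*v) T ^^ i) x" for i
    by (induction i) (simp_all flip: matrix_vector_mul_assoc)
  have sum: "sum f A *v x = (\<Sum>i\<in>A. f i *v x)" for f :: "nat \<Rightarrow> complex^'a^'a" and A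
    by (induction A rule: infinite_finite_induct) (simp_all add: matrix_vector_mult_add_rdistrib)
  show ?thesis
    by (simp only: poly_matrix_def sum matrix_vector_mul_assoc[symmetric] mat_vector_mult pow)
qed

text \<open>Horner's rule drives the inductions on polynomials below. The case \<open>p = 0\<close>
  is separate because \<open>degree (pCons a 0)\<close> is 0.\<close>

lemma poly_matrix_pCons:
  "poly_matrix (pCons a p) T *v x = a *s x + poly_matrix p T *v (T *v x)"
proof (cases "p = 0")
  case False
  then show ?thesis
    by (simp add: poly_matrix_mult_vector sum.atMost_Suc_shift funpow_swap1 del: sum.atMost_Suc)
qed (simp add: poly_matrix_mult_vector)

lemma poly_matrix_0 [simp]: "poly_matrix 0 T = 0"
  by (simp add: poly_matrix_def matrix_eq mat_vector_mult)

lemma poly_matrix_add: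
  "poly_matrix (p + q) T *v x = poly_matrix p T *v x + poly_matrix q T *v x"
  by (induction p q arbitrary: x rule: poly_induct2)
    (simp_all add: poly_matrix_pCons vec.scale_left_distrib)

lemma poly_matrix_smult: "poly_matrix (smult c p) T *v x = c *s (poly_matrix p T *v x)"
  by (induction p arbitrary: x) (simp_all add: poly_matrix_pCons vec.scale_right_distrib)

lemma poly_matrix_linear_factor:
  "poly_matrix ([:- l, 1:] * p) T *v x = poly_matrix p T *v (T *v x - l *s x)"
proof -
  have "poly_matrix ([:- l, 1:] * p) T *v x = - l *s (poly_matrix p T *v x) + poly_matrix p T *v (T *v x)"
    by (simp add: poly_matrix_add poly_matrix_smult poly_matrix_pCons mult_pCons_left del: smult_minus_left)
  then show ?thesis
    by (simp add: matrix_vector_smult_distribs)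
qed

text \<open>Turns annihilation by the minimal polynomial into the list form of the norm
  estimate.\<close>

lemma poly_matrix_prod_linear_factors:
  "poly_matrix (\<Prod>l\<leftarrow>ls. [:- l, 1:]) T *v x = shift_prod T ls x"
proof (induction ls arbitrary: x)
  case Nil
  show ?case by (simp add: poly_matrix_mult_vector)
next
  case (Cons l ls)
  then show ?case
    unfolding list.map prod_list.Cons poly_matrix_linear_factor by simp
qed

section \<open>Eigenvectors in invariant subspaces\<close>

lemma poly_matrix_mem_invariant_subspace:
  assumes "vec.subspace V" "\<And>x. x \<in> V \<Longrightarrow> T *v x \<in> V"
  shows "x \<in> V \<Longrightarrow> poly_matrix p T *v x \<in> V"
  by (induction p arbitrary: x)
    (simp_all add: poly_matrix_pCons assms vec.subspace_add vec.subspace_scale vec.subspace_0)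

text \<open>The vectors \<open>x, T x, ..., T^n x\<close> number one more than the dimension; a
  linear relation among them supplies the coefficients of \<open>p\<close>.\<close>

lemma ex_poly_matrix_mult_vector_eq_0:
  fixes T :: "complex^'n^'n"
  shows "\<exists>p. p \<noteq> 0 \<and> poly_matrix p T *v x = 0"
proof -
  let ?f = "\<lambda>i. ((*v) T ^^ i) x" and ?n = "CARD('n)"
  have monom: "poly_matrix (monom c i) T *v y = c *s ((*v) T ^^ i) y" for c i y
    by (induction i arbitrary: y) (simp_all add: monom_0 monom_Suc poly_matrix_pCons funpow_swap1)
  have sum: "poly_matrix (\<Sum>i\<in>A. monom (c i) i) T *v x = (\<Sum>i\<in>A. c i *s ?f i)" for c and A :: "nat set"
    by (induction A rule: infinite_finite_induct) (simp_all add: poly_matrix_add monom)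
  show ?thesis
  \<comment> \<open>Dependence is a property of sets, so coinciding iterates are treated apart; they
    give a difference of two monomials.\<close>
  proof (cases "inj_on ?f {..?n}")
    case True
    then have "card (?f ` {..?n}) > ?n"
      by (simp add: card_image)
    then have "vec.dependent (?f ` {..?n})"
      using vec.independent_card_le_dim[OF subset_UNIV, of "?f ` {..?n}"] unfolding vec_dim_card
      by linarith
    then obtain u j where u: "j \<le> ?n" "u (?f j) \<noteq> 0" "(\<Sum>v\<in>?f ` {..?n}. u v *s v) = 0"
      by (auto simp: vec.dependent_finite)
    let ?p = "\<Sum>i\<le>?n. monom (u (?f i)) i"
    have "coeff ?p j = u (?f j)"
      using u(1) by (simp add: coeff_sum sum.delta)
    then have "?p \<noteq> 0"
      using u(2) by (metis coeff_0)
    moreover have "poly_matrix ?p T *v x = 0"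
      using u(3) True unfolding sum by (simp add: sum.reindex)
    ultimately show ?thesis by blast
  next
    case False
    then obtain i j where ij: "?f i = ?f j" "i \<noteq> j"
      by (auto simp: inj_on_def)
    let ?p = "monom 1 i + smult (- 1) (monom 1 j) :: complex poly"
    have "coeff ?p i = 1"
      using ij by simp
    then have "?p \<noteq> 0"
      by (metis coeff_0 zero_neq_one)
    moreover have "poly_matrix ?p T *v x = 0"
      using ij(1) unfolding poly_matrix_add poly_matrix_smult monom by simp
    ultimately show ?thesis by blast
  qed
qed

text \<open>Take \<open>p\<close> of least degree with \<open>p(T) x = 0\<close> and split off a
  root, \<open>p = (X - c) q\<close>. By minimality \<open>q(T) x\<close> is nonzero, and
  \<open>T - c\<close> kills it.\<close>

lemma ex_eigenvector_invariant_subspace: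
  fixes T :: "complex^'n^'n"
  assumes V: "vec.subspace V" "\<And>x. x \<in> V \<Longrightarrow> T *v x \<in> V" and x: "x \<in> V" "x \<noteq> 0"
  obtains c v where "v \<in> V" "v \<noteq> 0" "T *v v = c *s v"
proof -
  obtain p where p: "p \<noteq> 0" "poly_matrix p T *v x = 0"
    and min: "\<And>q. q \<noteq> 0 \<Longrightarrow> poly_matrix q T *v x = 0 \<Longrightarrow> degree p \<le> degree q"
  proof -
    let ?P = "\<lambda>p. p \<noteq> 0 \<and> poly_matrix p T *v x = 0"
    obtain p0 where "?P p0"
      using ex_poly_matrix_mult_vector_eq_0 by blast
    then show thesis
      using ex_has_least_nat[of ?P p0 degree] that by blast
  qed
  have "degree p \<noteq> 0"
  proof
    assume "degree p = 0"
    then obtain a where "p = [:a:]"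
      by (rule degree_eq_zeroE)
    then show False
      using p x(2) by (simp add: poly_matrix_mult_vector)
  qed
  then have "\<exists>c. poly p c = 0"
    using fundamental_theorem_of_algebra constant_degree by metis
  then obtain c q where q: "p = [:- c, 1:] * q"
    by (auto simp: poly_eq_0_iff_dvd)
  let ?v = "poly_matrix q T *v x"
  have "q \<noteq> 0" using p(1) q by auto
  then have "degree q < degree p"
    unfolding q by (subst degree_mult_eq) auto
  then have "?v \<noteq> 0"
    using min[OF \<open>q \<noteq> 0\<close>] by auto
  moreover have "?v \<in> V"
    by (rule poly_matrix_mem_invariant_subspace[OF V x(1)])
  moreover have comm: "poly_matrix q T *v (T *v y) = T *v (poly_matrix q T *v y)" for y
    by (induction q arbitrary: y)
      (simp_all add: poly_matrix_pCons matrix_vector_right_distrib vector_scalar_commute)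
  have "poly_matrix p T *v x = T *v ?v - c *s ?v"
    unfolding q poly_matrix_linear_factor
    by (simp add: matrix_vector_smult_distribs comm)
  ultimately show ?thesis
    using that p(2) by simp
qed

lemma ex_annihilating_eigenvalues_invariant_subspace:
  fixes T :: "complex^'n^'n"
  assumes "vec.subspace V" "\<And>x. x \<in> V \<Longrightarrow> T *v x \<in> V"
  shows "\<exists>ls. length ls \<le> vec.dim V \<and> set ls \<subseteq> eigenvalues T \<and> (\<forall>x\<in>V. shift_prod T ls x = 0)"
  using assms
proof (induction "vec.dim V" arbitrary: V rule: less_induct)
  case less
  show ?case
  proof (cases "V \<subseteq> {0}")
    case True
    then show ?thesis by (intro exI[of _ "[]"]) auto
  next
    case False
    then obtain x where "x \<in> V" "x \<noteq> 0" by auto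
    then obtain c v where v: "v \<in> V" "v \<noteq> 0" "T *v v = c *s v"
      using ex_eigenvector_invariant_subspace less.prems by metis
    let ?f = "\<lambda>x. T *v x - c *s x"
    let ?W = "?f ` V"
    have "?f = (*v) (T - mat c)"
      by (simp add: fun_eq_iff matrix_vector_mult_diff_rdistrib mat_vector_mult)
    then have lin: "Vector_Spaces.linear (*s) (*s) ?f"
      by simp
    have dim: "vec.dim ?W < vec.dim V"
    proof -
      \<comment> \<open>In a basis of \<open>V\<close> containing \<open>v\<close>, which
        \<open>?f\<close> kills, the images of the other basis vectors already generate
        \<open>?W\<close>.\<close>
      have "vec.independent {v}" using v(2) by simp
      then obtain B where B: "{v} \<subseteq> B" "B \<subseteq> V" "vec.independent B" "V \<subseteq> vec.span B"
        using vec.maximal_independent_subset_extend[of "{v}" V] v(1) by auto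
      have fin: "finite B"
        using B(3) by (rule vec.finiteI_independent)
      have "?W \<subseteq> vec.span (?f ` B)"
        using B(4) vec.linear_span_image[OF lin, of B] by auto
      also have "?f ` B \<subseteq> insert 0 (?f ` (B - {v}))"
        using v(3) by auto
      then have "vec.span (?f ` B) \<subseteq> vec.span (?f ` (B - {v}))"
        using vec.span_mono[of "?f ` B" "insert 0 (?f ` (B - {v}))"] by (simp only: vec.span_insert_0)
      finally have "vec.dim ?W \<le> card (?f ` (B - {v}))"
        by (rule vec.dim_le_card) (use fin in simp)
      also have "\<dots> \<le> card (B - {v})"
        using fin by (intro card_image_le) simp
      also have "\<dots> < card B"
        using fin B(1) by (intro psubset_card_mono) auto
      also have "card B = vec.dim V"
        using B by (intro vec.basis_card_eq_dim)
      finally show ?thesis .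
    qed
    have "T *v y \<in> ?W" if "y \<in> ?W" for y
    proof -
      obtain z where "z \<in> V" "y = ?f z" using \<open>y \<in> ?W\<close> by auto
      then have "T *v y = ?f (T *v z)" "T *v z \<in> V"
        using less.prems by (simp_all add: matrix_vector_smult_distribs)
      then show ?thesis by blast
    qed
    then obtain ls where ls: "length ls \<le> vec.dim ?W" "set ls \<subseteq> eigenvalues T"
        "\<forall>x\<in>?W. shift_prod T ls x = 0"
      using less.hyps[OF dim] vec.linear_subspace_image[OF lin less.prems(1)] by blast
    have "c \<in> eigenvalues T"
      using v unfolding eigenvalues_def by auto
    then show ?thesis
      using ls dim by (intro exI[of _ "c # ls"]) auto
  qed
qed

text \<open>Equality with the spectrum, not mere inclusion in it, yields the finiteness on which
  \<open>Max\<close> in \<open>spectral_radius\<close> relies.\<close>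

lemma ex_annihilating_eigenvalues:
  fixes T :: "complex^'n^'n"
  obtains ls where "length ls \<le> CARD('n)" "set ls = eigenvalues T" "\<And>x. shift_prod T ls x = 0"
proof -
  obtain ls where ls: "length ls \<le> CARD('n)" "set ls \<subseteq> eigenvalues T"
      "\<And>x. shift_prod T ls x = 0"
    using ex_annihilating_eigenvalues_invariant_subspace[of UNIV T] unfolding vec_dim_card
    by auto
  have "c \<in> set ls" if "c \<in> eigenvalues T" for c
  proof -
    obtain v where v: "v \<noteq> 0" "T *v v = c *s v"
      using \<open>c \<in> eigenvalues T\<close> by (auto simp: eigenvalues_def)
    then have "(\<Prod>l\<leftarrow>ls. c - l) = 0"
      using shift_prod_eigenvector[OF v(2), of ls] ls(3)[of v] by simp
    then show ?thesis
      by (auto simp: prod_list_zero_iff)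
  qed
  then have "set ls = eigenvalues T"
    using ls(2) by auto
  then show ?thesis
    using that ls(1,3) by blast
qed

lemma finite_eigenvalues: "finite (eigenvalues T)"
  using ex_annihilating_eigenvalues[of T] by (metis List.finite_set)

lemma eigenvalues_nonempty: "eigenvalues (T :: complex^'n^'n) \<noteq> {}"
proof -
  have "(vec 1 :: complex^'n) \<noteq> 0" by (simp add: vec_eq_iff)
  then obtain c v where "v \<noteq> 0" "T *v v = c *s v"
    using ex_eigenvector_invariant_subspace[of UNIV T "vec 1"] vec.subspace_UNIV by blast
  then show ?thesis
    by (auto simp: eigenvalues_def)
qed

lemma spectral_radius_le_iff: "spectral_radius T \<le> r \<longleftrightarrow> (\<forall>c\<in>eigenvalues T. cmod c \<le> r)"
  unfolding spectral_radius_def using finite_eigenvalues[of T] eigenvalues_nonempty[of T]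
  by (subst Max_le_iff) auto

subsection \<open>The extremal matrix\<close>

text \<open>Through \<open>f\<close>, vectors become sequences \<open>h\<close>; the condition
  \<open>h CARD('n) = 0\<close> encodes the zero shifted in at the last place.\<close>

lemma ex_jordan_shift:
  fixes f :: "'n::finite \<Rightarrow> nat"
  assumes f: "bij_betw f UNIV {..<CARD('n)}"
  shows "\<exists>N :: complex^'n^'n. \<forall>h. h CARD('n) = 0 \<longrightarrow> N *v (\<chi> i. h (f i)) = (\<chi> i. h (Suc (f i)))"
proof (intro exI allI impI)
  let ?n = "CARD('n)"
  let ?N = "(\<chi> i j. if f j = Suc (f i) then 1 else 0) :: complex^'n^'n"
  fix h :: "nat \<Rightarrow> complex" assume h: "h ?n = 0"
  have "(?N *v (\<chi> i. h (f i))) $ i = h (Suc (f i))" for i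
  proof -
    have lt: "f i < ?n"
      using bij_betwE[OF f] by simp
    have "(?N *v (\<chi> i. h (f i))) $ i = (\<Sum>j\<in>UNIV. if f j = Suc (f i) then h (f j) else 0)"
      unfolding matrix_vector_mult_def by (auto intro!: sum.cong)
    also have "\<dots> = (\<Sum>k<?n. if k = Suc (f i) then h k else 0)"
      by (rule sum.reindex_bij_betw[OF f, of "\<lambda>k. if k = Suc (f i) then h k else 0"])
    also have "\<dots> = (if Suc (f i) < ?n then h (Suc (f i)) else 0)"
      by (simp add: sum.delta)
    also have "\<dots> = h (Suc (f i))"
      using lt h by (metis Suc_lessI)
    finally show ?thesis .
  qed
  then show "?N *v (\<chi> i. h (f i)) = (\<chi> i. h (Suc (f i)))"
    by (simp add: vec_eq_iff)
qed

text \<open>Up to the rotation by \<open>\<zeta>\<close>, the extremal \<open>T\<close> is the Moebius transform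
  \<open>(N + r) (1 + r N)\<^sup>-\<^sup>1\<close> of the nilpotent shift \<open>N\<close>. Then
  \<open>(1 - T)\<^sup>-\<^sup>1 = (1 + r N) (1 - N)\<^sup>-\<^sup>1 / (1 - r)\<close>
  is tested on the all-ones vector, whose preimage under \<open>1 - N\<close> is \<open>(n, n - 1, \<dots>, 1)\<close>.\<close>

lemma ex_contraction_opnorm_resolvent_ge:
  assumes z: "cmod \<zeta> = 1" and r: "0 \<le> r" "r < 1"
  shows "\<exists>T :: complex^'n^'n. contraction T \<and> spectral_radius T \<le> r \<and>
    1 / 2 * ((1 + r) / (1 - r)) * real CARD('n) + 1 / 2 \<le> opnorm (resolvent \<zeta> T)"
proof -
  define n where "n = CARD('n)"
  have n: "n > 0" unfolding n_def by simp
  obtain f :: "'n \<Rightarrow> nat" where f: "bij_betw f UNIV {..<n}"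
    using ex_bij_betw_finite_nat[of "UNIV :: 'n set"] unfolding n_def lessThan_atLeast0 by auto
  obtain N :: "complex^'n^'n" where
    N: "h n = 0 \<Longrightarrow> N *v (\<chi> i. h (f i)) = (\<chi> i. h (Suc (f i)))" for h
    using ex_jordan_shift f unfolding n_def by blast
  have f_sum: "(\<Sum>i\<in>UNIV. g (f i)) = (\<Sum>k<n. g k)" for g :: "nat \<Rightarrow> real"
    by (rule sum.reindex_bij_betw[OF f])
  have coords: "\<exists>h. h n = 0 \<and> x = (\<chi> i. h (f i))" for x :: "complex^'n"
  proof -
    let ?h = "\<lambda>k. if k < n then x $ inv f k else 0"
    have "x = (\<chi> i. ?h (f i))"
      using bij_betwE[OF f] bij_betw_imp_inj_on[OF f] by (simp add: vec_eq_iff)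
    then show ?thesis
      by (intro exI[of _ ?h]) simp
  qed
  have normsq: "norm ((\<chi> i. h (f i)) :: complex^'n) ^ 2 = (\<Sum>k<n. cmod (h k) ^ 2)" for h
    using f_sum[of "\<lambda>k. cmod (h k) ^ 2"] by (simp add: norm_vec_def L2_set_def sum_nonneg)
  have "norm (N *v x) \<le> norm x" for x
  proof -
    obtain h where h: "h n = 0" "x = (\<chi> i. h (f i))"
      using coords by blast
    have "norm (N *v x) ^ 2 = (\<Sum>k<n. cmod (h (Suc k)) ^ 2)"
      unfolding h(2) N[of h, OF h(1)] by (rule normsq)
    \<comment> \<open>The shift loses only \<open>h 0\<close>, and the added index \<open>n\<close>
      contributes nothing to the norm of \<open>x\<close> since \<open>h n = 0\<close>.\<close>
    also have "\<dots> \<le> (\<Sum>k<Suc n. cmod (h k) ^ 2)"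
      by (subst sum.lessThan_Suc_shift) simp
    also have "\<dots> = norm x ^ 2"
      unfolding h(2) normsq using h(1) by simp
    finally show ?thesis
      by (rule power2_le_imp_le) simp
  qed
  then have N_contr: "contraction N"
    by (simp add: contraction_iff)
  \<comment> \<open>The eigenvalue equation reads \<open>h (Suc k) = c * h k\<close>, so
    \<open>h n = 0\<close> propagates down to index 0.\<close>
  have N_eig: "x = 0" if x: "N *v x = c *s x" "c \<noteq> 0" for x c
  proof -
    obtain h where h: "h n = 0" "x = (\<chi> i. h (f i))"
      using coords by blast
    have step: "h k = 0" if k: "k < n" "h (Suc k) = 0" for k
    proof -
      have "k \<in> f ` UNIV"
        using f k(1) by (simp add: bij_betw_def)
      then obtain i where "f i = k" by auto
      moreover have "(N *v x) $ i = h (Suc (f i))"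
        using N[of h, OF h(1)] h(2) by simp
      ultimately have "h (Suc k) = c * h k"
        using x(1) h(2) by simp
      then show ?thesis
        using x(2) k(2) by simp
    qed
    have "h k = 0" if "k \<le> n" for k
      using that by (induction rule: inc_induct) (use h(1) step in auto)
    then show ?thesis
      using bij_betwE[OF f] unfolding h(2) by (simp add: vec_eq_iff less_imp_le)
  qed
  let ?D = "mat 1 + mat (of_real r) ** N"
  have D: "?D *v u = u - (- of_real r) *s (N *v u)" for u
    by (simp add: matrix_vector_mult_add_rdistrib mat_vector_mult flip: matrix_vector_mul_assoc)
  have r': "cmod (- of_real r) < 1"
    using r by simp
  have "u = 0" if "?D *v u = 0" for u
    using contraction_shift_lower_bound[OF N_contr r', of u] that r unfolding D
    by (simp add: mult_le_0_iff)
  then have "\<exists>S. S ** ?D = mat 1"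
    by (simp add: matrix_left_invertible_ker)
  then obtain S where S: "S ** ?D = mat 1" "?D ** S = mat 1"
    using matrix_left_right_inverse by blast
  have D_surj: "\<exists>u. x = ?D *v u" for x
    using S(2) by (intro exI[of _ "S *v x"]) (simp add: matrix_vector_mul_assoc)
  define T where "T = mat \<zeta> ** ((N + mat (of_real r)) ** S)"
  \<comment> \<open>Every vector is some \<open>?D *v u\<close>, so \<open>T\<close> is studied
    through \<open>u\<close>. The form \<open>- of_real r\<close> fits the Blaschke estimate with
    \<open>l = - r\<close>.\<close>
  have T: "T *v (?D *v u) = \<zeta> *s (N *v u - (- of_real r) *s u)" for u
  proof -
    have "S *v (?D *v u) = u"
      by (simp only: matrix_vector_mul_assoc S(1) matrix_vector_mul_lid)
    then show ?thesis
      unfolding T_def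
      by (simp only: matrix_vector_mul_assoc[symmetric] mat_vector_mult matrix_vector_mult_add_rdistrib)
        simp
  qed
  have T_contr: "contraction T"
    unfolding contraction_iff
  proof
    fix x
    obtain u where u: "x = ?D *v u"
      using D_surj by blast
    have "norm (T *v x) = norm (N *v u - (- of_real r) *s u)"
      unfolding u T by (simp only: norm_vector_smult z mult_1)
    also have "\<dots> \<le> norm (u - cnj (- of_real r) *s (N *v u))"
      using N_contr r by (intro norm_blaschke_le) (simp_all add: contraction_iff)
    also have "\<dots> = norm x"
      unfolding u D by simp
    finally show "norm (T *v x) \<le> norm x" .
  qed
  have T_rad: "cmod c \<le> r" if c: "c \<in> eigenvalues T" for c
  proof (rule ccontr)
    assume neg: "\<not> cmod c \<le> r"
    obtain w where w: "w \<noteq> 0" "T *v w = c *s w"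
      using c by (auto simp: eigenvalues_def)
    obtain u where u: "w = ?D *v u"
      using D_surj by blast
    have cz: "c - \<zeta> * of_real r \<noteq> 0"
    proof
      assume "c - \<zeta> * of_real r = 0"
      then have "cmod c = r"
        using z r by (simp add: norm_mult)
      with neg show False by simp
    qed
    \<comment> \<open>The eigenvalue equation of \<open>T\<close> becomes one for \<open>N\<close>
      whose eigenvalue has a nonzero numerator, because \<open>cmod c > r\<close>; hence
      \<open>u = 0\<close>.\<close>
    have eq: "(\<zeta> - c * of_real r) *s (N *v u) = (c - \<zeta> * of_real r) *s u"
      using w(2) unfolding u T unfolding D by (simp add: vec_eq_iff algebra_simps)
    have "u = 0"
    proof (cases "\<zeta> - c * of_real r = 0")
      case True
      then show ?thesis using eq cz by simp
    next
      case False
      then have "N *v u = ((c - \<zeta> * of_real r) / (\<zeta> - c * of_real r)) *s u"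
        using eq by (simp add: vec_eq_iff field_simps)
      then show ?thesis
        by (rule N_eig) (use False cz in simp)
    qed
    with w(1) u show False by simp
  qed
  define R where "R = resolvent \<zeta> T"
  have "\<zeta> \<notin> eigenvalues T"
    using T_rad z r by fastforce
  then have "invertible (mat \<zeta> - T)"
    by (rule invertible_resolvent)
  then have "R ** (mat \<zeta> - T) = mat 1"
    unfolding R_def resolvent_def by (rule matrix_inv_left)
  then have R: "R *v (\<zeta> *s x - T *v x) = x" for x
    using matrix_vector_mul_assoc[of R "mat \<zeta> - T" x]
    by (simp add: matrix_vector_mult_diff_rdistrib mat_vector_mult)
  define v :: "complex^'n" where "v = (\<chi> i. of_nat (n - f i))"
  define w where "w = ?D *v v"
  have Nv: "N *v v = (\<chi> i. of_nat (n - Suc (f i)))"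
    unfolding v_def by (rule N[of "\<lambda>k. of_nat (n - k)"]) simp
  have f_lt: "f i < n" for i
    using bij_betwE[OF f] by simp
  have "of_nat (n - f i) - of_nat (n - Suc (f i)) = (1 :: complex)" for i
    using f_lt[of i] by (simp add: of_nat_diff)
  then have "v - N *v v = vec 1"
    unfolding Nv unfolding v_def by (simp add: vec_eq_iff)
  moreover have "\<zeta> *s w - T *v w = (\<zeta> * of_real (1 - r)) *s (v - N *v v)"
    unfolding w_def T unfolding D by (simp add: vec_eq_iff algebra_simps)
  ultimately have "R *v ((\<zeta> * of_real (1 - r)) *s vec 1) = w"
    using R[of w] by simp
  moreover have "norm (R *v x) \<le> opnorm R * norm x" for x
    unfolding opnorm_def by (rule onorm) (rule matrix_vector_mul_bounded_linear)
  ultimately have "norm w \<le> opnorm R * norm ((\<zeta> * of_real (1 - r)) *s vec 1 :: complex^'n)"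
    by metis
  then have w_le: "norm w \<le> opnorm R * ((1 - r) * norm (vec 1 :: complex^'n))"
    using z r unfolding norm_vector_smult norm_mult norm_of_real by simp
  have one: "norm (vec 1 :: complex^'n) ^ 2 = n"
    by (simp add: norm_vec_def L2_set_def n_def)
  \<comment> \<open>Two triangular numbers, \<open>m (m + 1) / 2\<close> and
    \<open>m (m - 1) / 2\<close>, doubled to avoid division.\<close>
  have gauss: "(\<Sum>k<m. real (m - k) + r * real (m - Suc k)) * 2 = real m * ((real m + 1) + r * (real m - 1))" for m
  proof (induction m)
    case (Suc m)
    then show ?case
      by (simp add: sum.lessThan_Suc_shift algebra_simps del: sum.lessThan_Suc)
  qed simp
  \<comment> \<open>Pairing with the all-ones vector and Cauchy-Schwarz bound \<open>norm w\<close>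
    from below by an arithmetic sum.\<close>
  have "inner (vec 1) w = (\<Sum>i\<in>UNIV. real (n - f i) + r * real (n - Suc (f i)))"
    unfolding inner_vec_def w_def D Nv unfolding v_def by (simp add: inner_complex_def)
  also have "\<dots> = (\<Sum>k<n. real (n - k) + r * real (n - Suc k))"
    by (rule f_sum)
  also have "\<dots> = real n * ((real n + 1) + r * (real n - 1)) / 2"
    using gauss[of n] by linarith
  finally have "real n * ((real n + 1) + r * (real n - 1)) / 2 \<le> norm (vec 1 :: complex^'n) * norm w"
    by (metis norm_cauchy_schwarz)
  also have "\<dots> \<le> norm (vec 1 :: complex^'n) * (opnorm R * ((1 - r) * norm (vec 1 :: complex^'n)))"
    using w_le by (rule mult_left_mono) simp
  also have "\<dots> = opnorm R * ((1 - r) * norm (vec 1 :: complex^'n) ^ 2)"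
    by (simp only: power2_eq_square mult_ac)
  also have "\<dots> = real n * (opnorm R * (1 - r))"
    unfolding one by (simp only: mult_ac)
  finally have "real n * (((real n + 1) + r * (real n - 1)) / 2) \<le> real n * (opnorm R * (1 - r))"
    by simp
  then have "((real n + 1) + r * (real n - 1)) / 2 \<le> opnorm R * (1 - r)"
    using n by (subst (asm) mult_le_cancel_left_pos) auto
  then have "((real n + 1) + r * (real n - 1)) / 2 / (1 - r) \<le> opnorm R"
    using r by (simp only: pos_divide_le_eq diff_gt_0_iff_gt)
  \<comment> \<open>The numerator is \<open>n (1 + r) + (1 - r)\<close>; its second part produces
    the summand 1/2.\<close>
  moreover have "((real n + 1) + r * (real n - 1)) / 2 / (1 - r) = 1 / 2 * ((1 + r) / (1 - r)) * real n + 1 / 2"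
    using r by (simp add: field_simps)
  ultimately show ?thesis
    using T_contr T_rad unfolding R_def n_def spectral_radius_le_iff[symmetric]
    by (intro exI[of _ T]) (auto simp: spectral_radius_le_iff)
qed

theorem theorem3:
  "(\<forall>(T :: complex^'n^'n) m lam \<zeta>.
      contraction T \<and> minimal_polynomial T m \<and>
      m = (\<Prod>k=1..degree m. [:- lam k, 1:]) \<and>
      (\<forall>k\<in>{1..degree m}. cmod (lam k) < 1) \<and>
      cmod \<zeta> \<ge> 1 \<longrightarrow>
      opnorm (resolvent \<zeta> T) \<le> (\<Sum>k=1..degree m. (1 + cmod (lam k)) / (1 - cmod (lam k))))
   \<and> (\<forall>\<zeta> r. cmod \<zeta> = 1 \<and> 0 \<le> r \<and> r < 1 \<longrightarrow>
      resolvent_sup TYPE('n) \<zeta> r \<le> ereal ((1 + r) / (1 - r) * real CARD('n)))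
   \<and> (\<forall>\<zeta> r. cmod \<zeta> = 1 \<and> 0 \<le> r \<and> r < 1 \<longrightarrow>
      resolvent_sup TYPE('n) \<zeta> r \<ge> ereal (1 / 2 * ((1 + r) / (1 - r)) * real CARD('n) + 1 / 2))"
proof (intro conjI allI impI; elim conjE)
  fix T :: "complex^'n^'n" and m lam \<zeta>
  assume T: "contraction T" and m: "minimal_polynomial T m" "m = (\<Prod>k=1..degree m. [:- lam k, 1:])"
    and lam: "\<forall>k\<in>{1..degree m}. cmod (lam k) < 1" and z: "cmod \<zeta> \<ge> 1"
  define ks where "ks = [1..<Suc (degree m)]"
  have ks: "set ks = {1..degree m}" "distinct ks"
    unfolding ks_def by auto
  have "m = (\<Prod>l\<leftarrow>map lam ks. [:- l, 1:])"
    using m(2) prod.distinct_set_conv_list[OF ks(2), of "\<lambda>k. [:- lam k, 1:]"]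
    by (simp add: ks o_def)
  then have "shift_prod T (map lam ks) x = 0" for x
    using m(1) poly_matrix_prod_linear_factors[of "map lam ks" T x]
    by (simp add: minimal_polynomial_def)
  then have "opnorm (resolvent \<zeta> T) \<le> (\<Sum>l\<leftarrow>map lam ks. (1 + cmod l) / (1 - cmod l))"
    using lam by (intro opnorm_resolvent_le[OF T z]) (auto simp: ks)
  also have "\<dots> = (\<Sum>k=1..degree m. (1 + cmod (lam k)) / (1 - cmod (lam k)))"
    using sum.distinct_set_conv_list[OF ks(2), of "\<lambda>k. (1 + cmod (lam k)) / (1 - cmod (lam k))"]
    by (simp add: ks o_def)
  finally show "opnorm (resolvent \<zeta> T) \<le> \<dots>" .
next
  fix \<zeta> :: complex and r :: real
  assume z: "cmod \<zeta> = 1" and r: "0 \<le> r" "r < 1"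
  have "opnorm (resolvent \<zeta> T) \<le> (1 + r) / (1 - r) * real CARD('n)"
    if T: "contraction T" "spectral_radius T \<le> r" for T :: "complex^'n^'n"
  proof -
    \<comment> \<open>Only the length of this list and the moduli of its entries enter, so the
      minimal polynomial is bypassed.\<close>
    obtain ls where ls: "length ls \<le> CARD('n)" "set ls = eigenvalues T" "\<And>x. shift_prod T ls x = 0"
      using ex_annihilating_eigenvalues[of T] by blast
    have le: "cmod l \<le> r" if "l \<in> set ls" for l
      using that T(2) by (simp add: ls(2) spectral_radius_le_iff)
    have "opnorm (resolvent \<zeta> T) \<le> (\<Sum>l\<leftarrow>ls. (1 + cmod l) / (1 - cmod l))"
      using le r z by (intro opnorm_resolvent_le[OF T(1) _ _ ls(3)]) fastforce+
    \<comment> \<open>The function \<open>(1 + t) / (1 - t)\<close> increases on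
      \<open>[0, 1)\<close>.\<close>
    also have "\<dots> \<le> (\<Sum>l\<leftarrow>ls. (1 + r) / (1 - r))"
      using le r by (intro sum_list_mono frac_le) fastforce+
    also have "\<dots> = real (length ls) * ((1 + r) / (1 - r))"
      by (simp only: sum_list_triv)
    also have "\<dots> \<le> real CARD('n) * ((1 + r) / (1 - r))"
      using ls(1) r by (intro mult_right_mono) simp_all
    finally show ?thesis
      by (simp only: mult_ac)
  qed
  then show "resolvent_sup TYPE('n) \<zeta> r \<le> ereal ((1 + r) / (1 - r) * real CARD('n))"
    unfolding resolvent_sup_def by (intro SUP_least) simp
next
  fix \<zeta> :: complex and r :: real
  assume "cmod \<zeta> = 1" "0 \<le> r" "r < 1"
  then obtain T :: "complex^'n^'n" where "contraction T" "spectral_radius T \<le> r"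
    and "1 / 2 * ((1 + r) / (1 - r)) * real CARD('n) + 1 / 2 \<le> opnorm (resolvent \<zeta> T)"
    using ex_contraction_opnorm_resolvent_ge by blast
  then show "resolvent_sup TYPE('n) \<zeta> r \<ge> ereal (1 / 2 * ((1 + r) / (1 - r)) * real CARD('n) + 1 / 2)"
    unfolding resolvent_sup_def by (intro SUP_upper2[of T]) simp_all
qed

end
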